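(* Let $\mathcal C$ and $\mathcal D$ be Reedy categories and let $G\colon \mathcal C \to \mathcal D$ be a Reedy functor that is not a fibering Reedy functor. Then there is a fibrant $\mathcal D$-diagram $X$ of topological spaces (i.e., a fibrant object of $\mathrm{Top}^{\mathcal D}$ in the Reedy model category structure) for which the induced $\mathcal C$-diagram $G^{*}X$ is not fibrant in $\mathrm{Top}^{\mathcal C}$.
   Context: $\mathrm{Top}$ is the standard (Quillen) model category of topological spaces. A Reedy category is a small category $\mathcal C$ together with two subcategories $\overrightarrow{\mathcal C}$ (the direct subcategory) and $\overleftarrow{\mathcal C}$ (the inverse subcategory), both containing all objects of $\mathcal C$, such that every object can be assigned a nonnegative integer (its degree) so that: every non-identity map of $\overrightarrow{\mathcal C}$ raises degree; every non-identity map of $\overleftarrow{\mathcal C}$ lowers degree; every map $g$ of $\mathcal C$ has a unique factorization $g = \overrightarrow g\,\overleftarrow g$ with $\overrightarrow g$ in $\overrightarrow{\mathcal C}$ and $\overleftarrow g$ in $\overleftarrow{\mathcal C}$. A Reedy functor $G\colon \mathcal C\to\mathcal D$ between Reedy categories is a functor taking $\overrightarrow{\mathcal C}$ into $\overrightarrow{\mathcal D}$ and $\overleftarrow{\mathcal C}$ into $\overleftarrow{\mathcal D}$ (it need not respect degrees, and may take non-identity maps to identity maps). Category of inverse $\mathcal C$-factorizations. Let $\alpha\in\mathrm{Ob}(\mathcal C)$, $\beta\in\mathrm{Ob}(\mathcal D)$ and let $\sigma\colon G\alpha\to\beta$ be a map in $\overleftarrow{\mathcal D}$. The category $\mathrm{Fact}_{\overleftarrow{\mathcal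 C}}(\alpha,\sigma)$ has as objects the pairs $\bigl((\nu\colon\alpha\to\gamma),(\mu\colon G\gamma\to\beta)\bigr)$ with $\nu$ a non-identity map in $\overleftarrow{\mathcal C}$, $\mu$ a map in $\overleftarrow{\mathcal D}$, and $\mu\circ G\nu=\sigma$; a map from $\bigl((\nu\colon\alpha\to\gamma),\mu\bigr)$ to $\bigl((\nu'\colon\alpha\to\gamma'),\mu'\bigr)$ is a map $\tau\colon\gamma\to\gamma'$ in $\overleftarrow{\mathcal C}$ with $\tau\nu=\nu'$ and $\mu'\circ G\tau=\mu$. $G$ is a fibering Reedy functor if for every $\alpha\in\mathrm{Ob}(\mathcal C)$, every $\beta\in\mathrm{Ob}(\mathcal D)$ and every map $\sigma\colon G\alpha\to\beta$ in $\overleftarrow{\mathcal D}$, the nerve of $\mathrm{Fact}_{\overleftarrow{\mathcal C}}(\alpha,\sigma)$ is either empty or connected. Diagrams. For a model category $\mathcal M$, $\mathcal M^{\mathcal C}$ is the category of functors $\mathcal C\to\mathcal M$ and natural transformations. $G^{*}\colon \mathcal M^{\mathcal D}\to\mathcal M^{\mathcal C}$ is precomposition with $G$. For a $\mathcal C$-diagram $X$ and $\alpha\in\mathrm{Ob}(\mathcal C)$, the matching category at $\alpha$ is the full subcategory of the undercategory $(\alpha\downarrow\overleftarrow{\mathcal C})$ on all objects except $1_\alpha$, and the matching object $\mathrm M_\alpha X$ is the limit of $X$ over it. In the Reedy model category structure on $\mathcal M^{\mathcal C}$ weak equivalences are objectwise and a map $X\to Y$ is a fibration if for every $\alpha$ the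 relative matching map $X_\alpha\to Y_\alpha\times_{\mathrm M_\alpha Y}\mathrm M_\alpha X$ is a fibration; in particular $X$ is fibrant if and only if every matching map $X_\alpha\to\mathrm M_\alpha X$ is a fibration in $\mathcal M$. *)

theory Defs
  imports "HOL-Analysis.Analysis"
begin

section \<open>Small categories and functors\<close>

text \<open>Composition is written in applicative order: \<open>Comp C g f\<close> is ``\<open>g\<close> after \<open>f\<close>''.\<close>

record ('o, 'a) precat =
  Obj :: "'o set"
  Arr :: "'a set"
  Dom :: "'a \<Rightarrow> 'o"
  Cod :: "'a \<Rightarrow> 'o"
  Id :: "'o \<Rightarrow> 'a"
  Comp :: "'a \<Rightarrow> 'a \<Rightarrow> 'a"

locale category =
  fixes C :: "('o, 'a, 'm) precat_scheme"
  assumes Dom_in_Obj: "f \<in> Arr C \<Longrightarrow> Dom C f \<in> Obj C"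
    and Cod_in_Obj: "f \<in> Arr C \<Longrightarrow> Cod C f \<in> Obj C"
    and Id_in_Arr: "x \<in> Obj C \<Longrightarrow> Id C x \<in> Arr C"
    and Dom_Id: "x \<in> Obj C \<Longrightarrow> Dom C (Id C x) = x"
    and Cod_Id: "x \<in> Obj C \<Longrightarrow> Cod C (Id C x) = x"
    and Comp_in_Arr:
      "\<lbrakk>f \<in> Arr C; g \<in> Arr C; Cod C f = Dom C g\<rbrakk> \<Longrightarrow> Comp C g f \<in> Arr C"
    and Dom_Comp:
      "\<lbrakk>f \<in> Arr C; g \<in> Arr C; Cod C f = Dom C g\<rbrakk> \<Longrightarrow> Dom C (Comp C g f) = Dom C f"
    and Cod_Comp:
      "\<lbrakk>f \<in> Arr C; g \<in> Arr C; Cod C f = Dom C g\<rbrakk> \<Longrightarrow> Cod C (Comp C g f) = Cod C g"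
    and Comp_Id_right: "f \<in> Arr C \<Longrightarrow> Comp C f (Id C (Dom C f)) = f"
    and Comp_Id_left: "f \<in> Arr C \<Longrightarrow> Comp C (Id C (Cod C f)) f = f"
    and Comp_assoc:
      "\<lbrakk>f \<in> Arr C; g \<in> Arr C; h \<in> Arr C; Cod C f = Dom C g; Cod C g = Dom C h\<rbrakk>
        \<Longrightarrow> Comp C h (Comp C g f) = Comp C (Comp C h g) f"

record ('o, 'a, 'p, 'b) fmap =
  OMap :: "'o \<Rightarrow> 'p"
  AMap :: "'a \<Rightarrow> 'b"

locale cat_functor = src: category C + tgt: category D
  for C :: "('o, 'a, 'm) precat_scheme"
    and D :: "('p, 'b, 'n) precat_scheme" +
  fixes F :: "('o, 'a, 'p, 'b) fmap"
  assumes OMap_in_Obj: "x \<in> Obj C \<Longrightarrow> OMap F x \<in> Obj D"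
    and AMap_in_Arr: "f \<in> Arr C \<Longrightarrow> AMap F f \<in> Arr D"
    and Dom_AMap: "f \<in> Arr C \<Longrightarrow> Dom D (AMap F f) = OMap F (Dom C f)"
    and Cod_AMap: "f \<in> Arr C \<Longrightarrow> Cod D (AMap F f) = OMap F (Cod C f)"
    and AMap_Id: "x \<in> Obj C \<Longrightarrow> AMap F (Id C x) = Id D (OMap F x)"
    and AMap_Comp:
      "\<lbrakk>f \<in> Arr C; g \<in> Arr C; Cod C f = Dom C g\<rbrakk>
        \<Longrightarrow> AMap F (Comp C g f) = Comp D (AMap F g) (AMap F f)"

definition fmap_comp ::
  "('p, 'b, 'q, 'c) fmap \<Rightarrow> ('o, 'a, 'p, 'b) fmap \<Rightarrow> ('o, 'a, 'q, 'c) fmap" where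
  "fmap_comp H F = \<lparr>OMap = OMap H \<circ> OMap F, AMap = AMap H \<circ> AMap F\<rparr>"

lemma cat_functor_fmap_comp:
  assumes "cat_functor C D F" "cat_functor D E H"
  shows "cat_functor C E (fmap_comp H F)"
proof -
  interpret F: cat_functor C D F by fact
  interpret H: cat_functor D E H by fact
  show ?thesis
    by unfold_locales
      (simp_all add: fmap_comp_def F.OMap_in_Obj F.AMap_in_Arr F.Dom_AMap F.Cod_AMap F.AMap_Id
        F.AMap_Comp H.OMap_in_Obj H.AMap_in_Arr H.Dom_AMap H.Cod_AMap H.AMap_Id H.AMap_Comp)
qed


section \<open>Reedy categories and Reedy functors\<close>

record ('o, 'a) reedy = "('o, 'a) precat" +
  Direct :: "'a set"
  Inverse :: "'a set"

definition wide_subcategory :: "('o, 'a, 'm) precat_scheme \<Rightarrow> 'a set \<Rightarrow> bool" where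
  "wide_subcategory C S \<longleftrightarrow>
     S \<subseteq> Arr C \<and> (\<forall>x\<in>Obj C. Id C x \<in> S) \<and>
     (\<forall>f\<in>S. \<forall>g\<in>S. Cod C f = Dom C g \<longrightarrow> Comp C g f \<in> S)"

definition nonidentity :: "('o, 'a, 'm) precat_scheme \<Rightarrow> 'a \<Rightarrow> bool" where
  "nonidentity C f \<longleftrightarrow> f \<noteq> Id C (Dom C f)"

locale reedy_category = category C
  for C :: "('o, 'a, 'm) reedy_scheme" +
  assumes Direct_subcategory: "wide_subcategory C (Direct C)"
    and Inverse_subcategory: "wide_subcategory C (Inverse C)"
    and degree_exists:
      "\<exists>deg :: 'o \<Rightarrow> nat.
         (\<forall>f\<in>Direct C. nonidentity C f \<longrightarrow> deg (Dom C f) < deg (Cod C f)) \<and>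
         (\<forall>f\<in>Inverse C. nonidentity C f \<longrightarrow> deg (Cod C f) < deg (Dom C f))"
    and unique_factorization:
      "g \<in> Arr C \<Longrightarrow>
         \<exists>!(d, i). d \<in> Direct C \<and> i \<in> Inverse C \<and> Cod C i = Dom C d \<and> g = Comp C d i"

locale reedy_functor =
  src: reedy_category C + tgt: reedy_category D + cat_functor C D G
  for C :: "('o, 'a, 'm) reedy_scheme"
    and D :: "('p, 'b, 'n) reedy_scheme"
    and G :: "('o, 'a, 'p, 'b) fmap" +
  assumes AMap_Direct: "AMap G ` Direct C \<subseteq> Direct D"
    and AMap_Inverse: "AMap G ` Inverse C \<subseteq> Inverse D"


section \<open>Nerves\<close>

text \<open>
  \<open>Act X m \<theta>\<close> is the operator from \<open>n\<close>-simplices to \<open>m\<close>-simplices induced by a monotone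
  map \<open>\<theta>\<close> from \<open>[m]\<close> to \<open>[n]\<close>.
\<close>

record 's sset =
  Simp :: "nat \<Rightarrow> 's set"
  Act :: "nat \<Rightarrow> (nat \<Rightarrow> nat) \<Rightarrow> 's \<Rightarrow> 's"

definition sset_empty :: "'s sset \<Rightarrow> bool" where
  "sset_empty X \<longleftrightarrow> (\<forall>n. Simp X n = {})"

text \<open>The pairs of endpoints \<open>(d\<^sub>1 e, d\<^sub>0 e)\<close> of the \<open>1\<close>-simplices \<open>e\<close>.\<close>

definition edge_rel :: "'s sset \<Rightarrow> 's rel" where
  "edge_rel X = {(Act X 0 (\<lambda>_. 0) e, Act X 0 (\<lambda>_. 1) e) | e. e \<in> Simp X 1}"

definition sset_components :: "'s sset \<Rightarrow> 's set set" where
  "sset_components X = Simp X 0 // (edge_rel X \<union> (edge_rel X)\<inverse>)\<^sup>*"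

definition sset_connected :: "'s sset \<Rightarrow> bool" where
  "sset_connected X \<longleftrightarrow> is_singleton (sset_components X)"

definition ordinal_cat :: "nat \<Rightarrow> (nat, nat \<times> nat) precat" where
  "ordinal_cat n =
     \<lparr>Obj = {..n}, Arr = {(i, j). i \<le> j \<and> j \<le> n}, Dom = fst, Cod = snd,
      Id = (\<lambda>i. (i, i)), Comp = (\<lambda>g f. (fst f, snd g))\<rparr>"

text \<open>
  An \<open>n\<close>-simplex of the nerve is a functor on \<open>[n]\<close>, normalised to be \<open>undefined\<close> off its domain
  so that equality of simplices is equality of functors.
\<close>

definition nerve ::
  "('o, 'a, 'm) precat_scheme \<Rightarrow> (nat, nat \<times> nat, 'o, 'a) fmap sset" where
  "nerve C =
     \<lparr>Simp = (\<lambda>n. {F. cat_functor (ordinal_cat n) C F \<and>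
                      OMap F \<in> extensional (Obj (ordinal_cat n)) \<and>
                      AMap F \<in> extensional (Arr (ordinal_cat n))}),
      Act = (\<lambda>m \<theta> F. \<lparr>OMap = (\<lambda>i\<in>Obj (ordinal_cat m). OMap F (\<theta> i)),
                       AMap = (\<lambda>f\<in>Arr (ordinal_cat m). AMap F (\<theta> (fst f), \<theta> (snd f)))\<rparr>)\<rparr>"


section \<open>Fibering Reedy functors\<close>

text \<open>
  Objects are pairs \<open>(\<nu>, \<mu>)\<close>; an arrow given by \<open>\<tau>\<close> is stored together with its source and target.
\<close>

definition inverse_fact_cat ::
  "('o, 'a, 'm) reedy_scheme \<Rightarrow> ('p, 'b, 'n) reedy_scheme \<Rightarrow> ('o, 'a, 'p, 'b) fmap \<Rightarrow>
   'o \<Rightarrow> 'b \<Rightarrow> ('a \<times> 'b, ('a \<times> 'b) \<times> 'a \<times> ('a \<times> 'b)) precat" where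
  "inverse_fact_cat C D G \<alpha> \<sigma> =
     (let Ob = {(\<nu>, \<mu>). \<nu> \<in> Inverse C \<and> nonidentity C \<nu> \<and> Dom C \<nu> = \<alpha> \<and>
                       \<mu> \<in> Inverse D \<and> Dom D \<mu> = OMap G (Cod C \<nu>) \<and> Cod D \<mu> = Cod D \<sigma> \<and>
                       Comp D \<mu> (AMap G \<nu>) = \<sigma>}
      in \<lparr>Obj = Ob,
          Arr = {((\<nu>, \<mu>), \<tau>, (\<nu>', \<mu>')). (\<nu>, \<mu>) \<in> Ob \<and> (\<nu>', \<mu>') \<in> Ob \<and>
                   \<tau> \<in> Inverse C \<and> Dom C \<tau> = Cod C \<nu> \<and> Cod C \<tau> = Cod C \<nu>' \<and>
                   Comp C \<tau> \<nu> = \<nu>' \<and> Comp D \<mu>' (AMap G \<tau>) = \<mu>},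
          Dom = (\<lambda>(a, \<tau>, b). a),
          Cod = (\<lambda>(a, \<tau>, b). b),
          Id = (\<lambda>a. (a, Id C (Cod C (fst a)), a)),
          Comp = (\<lambda>(b, \<tau>', c) (a, \<tau>, b'). (a, Comp C \<tau>' \<tau>, c))\<rparr>)"

definition fibering_reedy_functor ::
  "('o, 'a, 'm) reedy_scheme \<Rightarrow> ('p, 'b, 'n) reedy_scheme \<Rightarrow> ('o, 'a, 'p, 'b) fmap \<Rightarrow> bool" where
  "fibering_reedy_functor C D G \<longleftrightarrow>
     reedy_functor C D G \<and>
     (\<forall>\<alpha>\<in>Obj C. \<forall>\<beta>\<in>Obj D. \<forall>\<sigma>\<in>Inverse D.
        Dom D \<sigma> = OMap G \<alpha> \<and> Cod D \<sigma> = \<beta> \<longrightarrow>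
        sset_empty (nerve (inverse_fact_cat C D G \<alpha> \<sigma>)) \<or>
        sset_connected (nerve (inverse_fact_cat C D G \<alpha> \<sigma>)))"

lemma category_inverse_fact_cat:
  assumes "reedy_functor C D G" "\<alpha> \<in> Obj C" "\<sigma> \<in> Inverse D"
  shows "category (inverse_fact_cat C D G \<alpha> \<sigma>)"
proof -
  interpret reedy_functor C D G by fact
  have C: "\<And>f. f \<in> Inverse C \<Longrightarrow> f \<in> Arr C" "\<And>x. x \<in> Obj C \<Longrightarrow> Id C x \<in> Inverse C"
    "\<And>f g. f \<in> Inverse C \<Longrightarrow> g \<in> Inverse C \<Longrightarrow> Cod C f = Dom C g \<Longrightarrow> Comp C g f \<in> Inverse C"
    using src.Inverse_subcategory by (auto simp: wide_subcategory_def)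
  have D: "\<And>f. f \<in> Inverse D \<Longrightarrow> f \<in> Arr D"
    using tgt.Inverse_subcategory by (auto simp: wide_subcategory_def)
  note s = src.Dom_in_Obj src.Cod_in_Obj src.Dom_Id src.Cod_Id src.Dom_Comp src.Cod_Comp
    src.Comp_Id_left AMap_in_Arr Dom_AMap Cod_AMap AMap_Id
  show ?thesis
  proof (unfold_locales, goal_cases)
    case (3 x)
    then obtain \<nu> \<mu> where x: "x = (\<nu>, \<mu>)" and o: "x \<in> Obj (inverse_fact_cat C D G \<alpha> \<sigma>)"
      by (cases x)
    have "Comp C (Id C (Cod C \<nu>)) \<nu> = \<nu>" "Comp D \<mu> (AMap G (Id C (Cod C \<nu>))) = \<mu>"
      using o unfolding x
      by (auto simp: inverse_fact_cat_def Let_def C D s) (metis C(1) D tgt.Comp_Id_right)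
    then show ?case
      using o unfolding x
      by (simp add: inverse_fact_cat_def Let_def C D s)
  next
    case (6 f g)
    obtain \<nu> \<mu> \<tau> \<nu>' \<mu>' where f: "f = ((\<nu>, \<mu>), \<tau>, (\<nu>', \<mu>'))"
      by (metis prod.collapse)
    obtain \<tau>' \<nu>'' \<mu>'' where g: "g = ((\<nu>', \<mu>'), \<tau>', (\<nu>'', \<mu>''))"
      using 6(3) f by (cases g) (auto simp: inverse_fact_cat_def Let_def)
    have "Comp C (Comp C \<tau>' \<tau>) \<nu> = Comp C \<tau>' (Comp C \<tau> \<nu>)"
      using 6 unfolding f g
      by (intro src.Comp_assoc[symmetric]) (auto simp: inverse_fact_cat_def Let_def C)
    moreover have "AMap G (Comp C \<tau>' \<tau>) = Comp D (AMap G \<tau>') (AMap G \<tau>)"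
      using 6 unfolding f g
      by (intro AMap_Comp) (auto simp: inverse_fact_cat_def Let_def C)
    moreover have "Comp D \<mu>'' (Comp D (AMap G \<tau>') (AMap G \<tau>)) =
        Comp D (Comp D \<mu>'' (AMap G \<tau>')) (AMap G \<tau>)"
      using 6 unfolding f g
      by (intro tgt.Comp_assoc) (auto simp: inverse_fact_cat_def Let_def C D s)
    ultimately show ?case
      using 6 unfolding f g
      by (simp add: inverse_fact_cat_def Let_def C src.Dom_Comp src.Cod_Comp)
  next
    case (9 f)
    then show ?case
      by (auto simp: inverse_fact_cat_def Let_def) (metis C(1) src.Comp_Id_right)
  next
    case (10 f)
    then show ?case
      by (auto simp: inverse_fact_cat_def Let_def) (metis C(1) src.Comp_Id_left)
  next
    case (11 f g h)
    then show ?case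
      by (auto simp: inverse_fact_cat_def Let_def C intro!: src.Comp_assoc)
  qed (auto simp: inverse_fact_cat_def Let_def)
qed


section \<open>Topological spaces, limits and Serre fibrations\<close>

text \<open>
  The category of topological spaces with points in the type \<open>'x\<close>. A continuous map is stored with its
  source and target, and its underlying function is normalised to be \<open>undefined\<close> off the source.
\<close>

type_synonym 'x top_arrow = "'x topology \<times> ('x \<Rightarrow> 'x) \<times> 'x topology"

definition TOP :: "('x topology, 'x top_arrow) precat" where
  "TOP =
     \<lparr>Obj = UNIV,
      Arr = {(S, f, T). continuous_map S T f \<and> f \<in> extensional (topspace S)},
      Dom = (\<lambda>(S, f, T). S),
      Cod = (\<lambda>(S, f, T). T),
      Id = (\<lambda>S. (S, \<lambda>x\<in>topspace S. x, S)),
      Comp = (\<lambda>(T', g, U) (S, f, T). (S, compose (topspace S) g f, U))\<rparr>"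

lemma category_TOP: "category TOP"
proof -
  have 1: "continuous_map S S (restrict (\<lambda>x. x) (topspace S))" for S :: "'x topology"
    by (rule continuous_map_eq[OF continuous_map_id]) simp
  have 2: "continuous_map S U (compose (topspace S) g f)"
    if "continuous_map S T f" "continuous_map T U g" for S T U :: "'x topology" and f g
    by (rule continuous_map_eq[OF continuous_map_compose[OF that]]) (simp add: compose_eq)
  have 3: "f \<in> topspace S \<rightarrow> topspace T" if "continuous_map S T f" for S T :: "'x topology" and f
    using that by (simp add: continuous_map_def)
  have 4: "compose A f (restrict (\<lambda>x. x) A) = f" "compose A (restrict (\<lambda>x. x) B) f = f"
    if "f \<in> A \<rightarrow> B" "f \<in> extensional A" for f :: "'x \<Rightarrow> 'x" and A B
    using that Id_compose compose_Id by blast+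
  show ?thesis
  proof (unfold_locales, goal_cases)
    case (11 f g h)
    then show ?case
      by (auto simp: TOP_def intro!: compose_assoc[OF 3])
  next
    case (10 f)
    then show ?case
      by (auto simp: TOP_def intro!: 4(2)[OF 3])
  qed (auto simp: TOP_def intro: 1 2 4 3)
qed

type_synonym ('o, 'a, 'x) diagram = "('o, 'a, 'x topology, 'x top_arrow) fmap"

abbreviation diagram :: "('o, 'a, 'm) precat_scheme \<Rightarrow> ('o, 'a, 'x) diagram \<Rightarrow> bool" where
  "diagram C X \<equiv> cat_functor C TOP X"

definition umap :: "('o, 'a, 'x) diagram \<Rightarrow> 'a \<Rightarrow> 'x \<Rightarrow> 'x" where
  "umap X f = fst (snd (AMap X f))"

definition diagram_limit ::
  "('o, 'a, 'm) precat_scheme \<Rightarrow> ('o, 'a, 'x) diagram \<Rightarrow> ('o \<Rightarrow> 'x) topology" where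
  "diagram_limit J X =
     subtopology (product_topology (OMap X) (Obj J))
       {p. \<forall>f\<in>Arr J. umap X f (p (Dom J f)) = p (Cod J f)}"

text \<open>Maps into \<open>diagram_limit J X\<close> are cones over \<open>X\<close>.\<close>

lemma continuous_map_diagram_limit:
  "continuous_map S (diagram_limit J X) h \<longleftrightarrow>
     h ` topspace S \<subseteq> extensional (Obj J) \<and>
     (\<forall>j\<in>Obj J. continuous_map S (OMap X j) (\<lambda>s. h s j)) \<and>
     (\<forall>f\<in>Arr J. \<forall>s\<in>topspace S. umap X f (h s (Dom J f)) = h s (Cod J f))"
  by (auto simp: diagram_limit_def continuous_map_in_subtopology continuous_map_componentwise)

definition pullback_top ::
  "'x topology \<Rightarrow> 'y topology \<Rightarrow> ('x \<Rightarrow> 'z) \<Rightarrow> ('y \<Rightarrow> 'z) \<Rightarrow> ('x \<times> 'y) topology" where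
  "pullback_top S T f g = subtopology (prod_topology S T) {(x, y). f x = g y}"

definition disk :: "nat \<Rightarrow> (nat \<Rightarrow> real) topology" where
  "disk n = subtopology (Euclidean_space n) {x. (\<Sum>i<n. (x i)\<^sup>2) \<le> 1}"

text \<open>
  The fibrations of the Quillen model structure: the maps with the right lifting property with respect
  to the inclusions of \<open>disk n\<close> into \<open>disk n \<times> [0,1]\<close> at \<open>0\<close>, for all \<open>n \<ge> 0\<close>.
\<close>

definition serre_fibration :: "'x topology \<Rightarrow> 'y topology \<Rightarrow> ('x \<Rightarrow> 'y) \<Rightarrow> bool" where
  "serre_fibration E B p \<longleftrightarrow>
     continuous_map E B p \<and>
     (\<forall>n h H. continuous_map (disk n) E h \<and>
              continuous_map (prod_topology (disk n) (top_of_set {0..1::real})) B H \<and>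
              (\<forall>x\<in>topspace (disk n). H (x, 0) = p (h x)) \<longrightarrow>
        (\<exists>K. continuous_map (prod_topology (disk n) (top_of_set {0..1})) E K \<and>
             (\<forall>x\<in>topspace (disk n). K (x, 0) = h x) \<and>
             (\<forall>z\<in>topspace (disk n) \<times> {0..1}. p (K z) = H z)))"


section \<open>Matching objects and Reedy fibrations\<close>

text \<open>
  Objects are the non-identity arrows \<open>\<nu>\<close> of the inverse subcategory with domain \<open>\<alpha>\<close>; an arrow
  from \<open>\<nu>\<close> to \<open>\<nu>'\<close> given by \<open>\<tau>\<close> is stored as \<open>(\<nu>, \<tau>, \<nu>')\<close>.
\<close>

definition matching_cat ::
  "('o, 'a, 'm) reedy_scheme \<Rightarrow> 'o \<Rightarrow> ('a, 'a \<times> 'a \<times> 'a) precat" where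
  "matching_cat C \<alpha> =
     (let Ob = {\<nu> \<in> Inverse C. Dom C \<nu> = \<alpha> \<and> \<nu> \<noteq> Id C \<alpha>}
      in \<lparr>Obj = Ob,
          Arr = {(\<nu>, \<tau>, \<nu>'). \<nu> \<in> Ob \<and> \<nu>' \<in> Ob \<and> \<tau> \<in> Inverse C \<and>
                   Dom C \<tau> = Cod C \<nu> \<and> Cod C \<tau> = Cod C \<nu>' \<and> Comp C \<tau> \<nu> = \<nu>'},
          Dom = (\<lambda>(\<nu>, \<tau>, \<nu>'). \<nu>),
          Cod = (\<lambda>(\<nu>, \<tau>, \<nu>'). \<nu>'),
          Id = (\<lambda>\<nu>. (\<nu>, Id C (Cod C \<nu>), \<nu>)),
          Comp = (\<lambda>(\<nu>', \<tau>', \<nu>'') (\<nu>, \<tau>, \<nu>'''). (\<nu>, Comp C \<tau>' \<tau>, \<nu>''))\<rparr>)"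

definition matching_forget ::
  "('o, 'a, 'm) reedy_scheme \<Rightarrow> ('a, 'a \<times> 'a \<times> 'a, 'o, 'a) fmap" where
  "matching_forget C = \<lparr>OMap = Cod C, AMap = (\<lambda>(\<nu>, \<tau>, \<nu>'). \<tau>)\<rparr>"

lemma cat_functor_matching_forget:
  assumes "reedy_category C" "\<alpha> \<in> Obj C"
  shows "cat_functor (matching_cat C \<alpha>) C (matching_forget C)"
proof -
  interpret reedy_category C by fact
  have C: "\<And>f. f \<in> Inverse C \<Longrightarrow> f \<in> Arr C" "\<And>x. x \<in> Obj C \<Longrightarrow> Id C x \<in> Inverse C"
    "\<And>f g. f \<in> Inverse C \<Longrightarrow> g \<in> Inverse C \<Longrightarrow> Cod C f = Dom C g \<Longrightarrow> Comp C g f \<in> Inverse C"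
    using Inverse_subcategory by (auto simp: wide_subcategory_def)
  note s = Dom_in_Obj Cod_in_Obj Dom_Id Cod_Id Dom_Comp Cod_Comp
  interpret M: category "matching_cat C \<alpha>"
  proof (unfold_locales, goal_cases)
    case (3 \<nu>)
    then show ?case
      by (simp add: matching_cat_def Let_def C s Comp_Id_left)
  next
    case (6 f g)
    obtain \<nu> \<tau> \<nu>' where f: "f = (\<nu>, \<tau>, \<nu>')"
      by (metis prod.collapse)
    obtain \<tau>' \<nu>'' where g: "g = (\<nu>', \<tau>', \<nu>'')"
      using 6(3) f by (cases g) (auto simp: matching_cat_def Let_def)
    have "Comp C (Comp C \<tau>' \<tau>) \<nu> = Comp C \<tau>' (Comp C \<tau> \<nu>)"
      using 6 unfolding f g
      by (intro Comp_assoc[symmetric]) (auto simp: matching_cat_def Let_def C)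
    then show ?case
      using 6 unfolding f g
      by (simp add: matching_cat_def Let_def C Dom_Comp Cod_Comp)
  next
    case (9 f)
    then show ?case
      by (auto simp: matching_cat_def Let_def) (metis C(1) Comp_Id_right)
  next
    case (10 f)
    then show ?case
      by (auto simp: matching_cat_def Let_def) (metis C(1) Comp_Id_left)
  next
    case (11 f g h)
    then show ?case
      by (auto simp: matching_cat_def Let_def C intro!: Comp_assoc)
  qed (auto simp: matching_cat_def Let_def)
  show ?thesis
    by unfold_locales (auto simp: matching_cat_def matching_forget_def Let_def C Dom_in_Obj Cod_in_Obj)
qed

definition matching_object ::
  "('o, 'a, 'm) reedy_scheme \<Rightarrow> ('o, 'a, 'x) diagram \<Rightarrow> 'o \<Rightarrow> ('a \<Rightarrow> 'x) topology" where
  "matching_object C X \<alpha> = diagram_limit (matching_cat C \<alpha>) (fmap_comp X (matching_forget C))"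

definition matching_map ::
  "('o, 'a, 'm) reedy_scheme \<Rightarrow> ('o, 'a, 'x) diagram \<Rightarrow> 'o \<Rightarrow> 'x \<Rightarrow> 'a \<Rightarrow> 'x" where
  "matching_map C X \<alpha> x = (\<lambda>\<nu>\<in>Obj (matching_cat C \<alpha>). umap X \<nu> x)"

text \<open>
  Maps of diagrams are natural transformations \<open>\<eta>\<close> given by their underlying functions, so that the
  two diagrams may have different point types.
\<close>

definition diagram_map ::
  "('o, 'a, 'm) precat_scheme \<Rightarrow> ('o, 'a, 'x) diagram \<Rightarrow> ('o, 'a, 'y) diagram \<Rightarrow>
   ('o \<Rightarrow> 'x \<Rightarrow> 'y) \<Rightarrow> bool" where
  "diagram_map C X Y \<eta> \<longleftrightarrow>
     (\<forall>\<alpha>\<in>Obj C. continuous_map (OMap X \<alpha>) (OMap Y \<alpha>) (\<eta> \<alpha>)) \<and>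
     (\<forall>f\<in>Arr C. \<forall>x\<in>topspace (OMap X (Dom C f)).
        \<eta> (Cod C f) (umap X f x) = umap Y f (\<eta> (Dom C f) x))"

definition matching_object_map ::
  "('o, 'a, 'm) reedy_scheme \<Rightarrow> ('o \<Rightarrow> 'x \<Rightarrow> 'y) \<Rightarrow> 'o \<Rightarrow> ('a \<Rightarrow> 'x) \<Rightarrow> 'a \<Rightarrow> 'y" where
  "matching_object_map C \<eta> \<alpha> p = (\<lambda>\<nu>\<in>Obj (matching_cat C \<alpha>). \<eta> (Cod C \<nu>) (p \<nu>))"

definition relative_matching_object ::
  "('o, 'a, 'm) reedy_scheme \<Rightarrow> ('o, 'a, 'x) diagram \<Rightarrow> ('o, 'a, 'y) diagram \<Rightarrow>
   ('o \<Rightarrow> 'x \<Rightarrow> 'y) \<Rightarrow> 'o \<Rightarrow> ('y \<times> ('a \<Rightarrow> 'x)) topology" where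
  "relative_matching_object C X Y \<eta> \<alpha> =
     pullback_top (OMap Y \<alpha>) (matching_object C X \<alpha>)
       (matching_map C Y \<alpha>) (matching_object_map C \<eta> \<alpha>)"

definition relative_matching_map ::
  "('o, 'a, 'm) reedy_scheme \<Rightarrow> ('o, 'a, 'x) diagram \<Rightarrow> ('o \<Rightarrow> 'x \<Rightarrow> 'y) \<Rightarrow>
   'o \<Rightarrow> 'x \<Rightarrow> 'y \<times> ('a \<Rightarrow> 'x)" where
  "relative_matching_map C X \<eta> \<alpha> x = (\<eta> \<alpha> x, matching_map C X \<alpha> x)"

definition reedy_fibration ::
  "('o, 'a, 'm) reedy_scheme \<Rightarrow> ('o, 'a, 'x) diagram \<Rightarrow> ('o, 'a, 'y) diagram \<Rightarrow>
   ('o \<Rightarrow> 'x \<Rightarrow> 'y) \<Rightarrow> bool" where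
  "reedy_fibration C X Y \<eta> \<longleftrightarrow>
     diagram_map C X Y \<eta> \<and>
     (\<forall>\<alpha>\<in>Obj C. serre_fibration (OMap X \<alpha>) (relative_matching_object C X Y \<eta> \<alpha>)
                   (relative_matching_map C X \<eta> \<alpha>))"

definition terminal_diagram :: "('o, 'a, unit) diagram" where
  "terminal_diagram =
     (let pt = discrete_topology UNIV in \<lparr>OMap = (\<lambda>_. pt), AMap = (\<lambda>_. (pt, \<lambda>_. (), pt))\<rparr>)"

definition reedy_fibrant :: "('o, 'a, 'm) reedy_scheme \<Rightarrow> ('o, 'a, 'x) diagram \<Rightarrow> bool" where
  "reedy_fibrant C X \<longleftrightarrow> reedy_fibration C X terminal_diagram (\<lambda>_ _. ())"

lemma diagram_terminal_diagram:
  assumes "category C"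
  shows "diagram C terminal_diagram"
proof -
  interpret category C by fact
  interpret T: category TOP by (rule category_TOP)
  show ?thesis
    by unfold_locales (auto simp: terminal_diagram_def TOP_def Let_def)
qed

lemma serre_fibration_homeomorphic_base:
  assumes "homeomorphic_maps B B' f g"
    and p: "serre_fibration E B p"
  shows "serre_fibration E B' (f \<circ> p)"
proof -
  have f: "continuous_map B B' f" and g: "continuous_map B' B g"
    and gf: "\<And>x. x \<in> topspace B \<Longrightarrow> g (f x) = x"
    and fg: "\<And>y. y \<in> topspace B' \<Longrightarrow> f (g y) = y"
    using assms(1) by (auto simp: homeomorphic_maps_def)
  have cp: "continuous_map E B p"
    using p by (simp add: serre_fibration_def)
  show ?thesis
    unfolding serre_fibration_def
  proof (intro conjI allI impI)
    show "continuous_map E B' (f \<circ> p)"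
      using cp f by (rule continuous_map_compose)
    fix n h H
    let ?DI = "prod_topology (disk n) (top_of_set {0..1::real})"
    assume A: "continuous_map (disk n) E h \<and> continuous_map ?DI B' H \<and>
      (\<forall>x\<in>topspace (disk n). H (x, 0) = (f \<circ> p) (h x))"
    then have gH: "continuous_map ?DI B (g \<circ> H)"
      using g continuous_map_compose by blast
    have "(g \<circ> H) (x, 0) = p (h x)" if "x \<in> topspace (disk n)" for x
    proof -
      have "h x \<in> topspace E"
        using A that by (auto simp: continuous_map_def)
      then have "p (h x) \<in> topspace B"
        using cp by (auto simp: continuous_map_def)
      then show ?thesis
        using A that gf by simp
    qed
    then obtain K where K: "continuous_map ?DI E K"
      "\<forall>x\<in>topspace (disk n). K (x, 0) = h x"
      "\<forall>z\<in>topspace (disk n) \<times> {0..1}. p (K z) = (g \<circ> H) z"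
      using p A gH unfolding serre_fibration_def by blast
    moreover have "(f \<circ> p) (K z) = H z" if "z \<in> topspace (disk n) \<times> {0..1}" for z
    proof -
      have "H z \<in> topspace B'"
        using A that by (auto simp: continuous_map_def Pi_iff)
      then show ?thesis
        using bspec[OF K(3) that] fg by simp
    qed
    ultimately show "\<exists>K. continuous_map ?DI E K \<and>
        (\<forall>x\<in>topspace (disk n). K (x, 0) = h x) \<and>
        (\<forall>z\<in>topspace (disk n) \<times> {0..1}. (f \<circ> p) (K z) = H z)"
      by blast
  qed
qed

lemma reedy_fibrant_iff:
  "reedy_fibrant C X \<longleftrightarrow>
    (\<forall>\<alpha>\<in>Obj C. serre_fibration (OMap X \<alpha>) (matching_object C X \<alpha>) (matching_map C X \<alpha>))"
proof -
  let ?\<eta> = "\<lambda>_ _. ()" and ?T = "terminal_diagram :: ('a, 'b, unit) diagram"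
  have nat: "diagram_map C X ?T ?\<eta>"
    by (auto simp: diagram_map_def terminal_diagram_def Let_def)
  have hom: "homeomorphic_maps (relative_matching_object C X ?T ?\<eta> \<alpha>)
      (matching_object C X \<alpha>) snd (Pair ())" for \<alpha>
  proof -
    have "relative_matching_object C X ?T ?\<eta> \<alpha> =
        prod_topology (discrete_topology UNIV) (matching_object C X \<alpha>)"
      by (simp add: relative_matching_object_def pullback_top_def terminal_diagram_def Let_def
          matching_object_map_def matching_map_def umap_def)
    then show ?thesis
      by (simp add: homeomorphic_maps_def continuous_map_snd continuous_map_pairedI)
  qed
  have "serre_fibration (OMap X \<alpha>) (relative_matching_object C X ?T ?\<eta> \<alpha>)
          (relative_matching_map C X ?\<eta> \<alpha>) \<longleftrightarrow>
        serre_fibration (OMap X \<alpha>) (matching_object C X \<alpha>) (matching_map C X \<alpha>)" for \<alpha>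
  proof -
    have 1: "snd \<circ> relative_matching_map C X ?\<eta> \<alpha> = matching_map C X \<alpha>"
      and 2: "Pair () \<circ> matching_map C X \<alpha> = relative_matching_map C X ?\<eta> \<alpha>"
      by (auto simp: relative_matching_map_def)
    show ?thesis
      using serre_fibration_homeomorphic_base[OF hom[of \<alpha>],
          of "OMap X \<alpha>" "relative_matching_map C X ?\<eta> \<alpha>"]
        serre_fibration_homeomorphic_base[OF hom[of \<alpha>, THEN homeomorphic_maps_sym[THEN iffD1]],
          of "OMap X \<alpha>" "matching_map C X \<alpha>"]
      by (auto simp: 1 2)
  qed
  then show ?thesis
    using nat by (simp add: reedy_fibrant_def reedy_fibration_def)
qed

end

theory Submission
  imports Defs
begin

text \<open>
  Since \<open>G\<close> is not fibering, there is an inverse map \<open>\<sigma>: G\<alpha> \<rightarrow> \<beta>\<close> of \<open>D\<close> whose category of inverse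
  \<open>C\<close>-factorizations is nonempty and disconnected. The witness depends only on \<open>\<beta>\<close>: it is the diagram
  \<open>X\<^sub>\<gamma> = \<real>\<^bsup>I(\<gamma>,\<beta>)\<^esup>\<close>, where \<open>I(\<gamma>,\<beta>)\<close> is the set of inverse maps \<open>\<gamma> \<rightarrow> \<beta>\<close> and \<open>g: \<gamma> \<rightarrow> \<gamma>'\<close> sends \<open>p\<close> to
  \<open>f \<mapsto> p(f g)\<close>, with \<open>p\<close> extended by zero to all maps \<open>\<gamma> \<rightarrow> \<beta>\<close>. Conceptually, \<open>X\<close> is \<open>\<real>\<close> at \<open>\<beta>\<close>, a point
  at the other objects of degree at most that of \<open>\<beta>\<close>, and is right Kan extended from there. That it is a
  functor rests on the fact that a left factor of an inverse map is again inverse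
  (\<open>Inverse_left_factor\<close>), so that dropping the maps that are not inverse is compatible with composition.

  Matching objects of such a diagram see connected components. In \<open>D\<close> itself, the category of
  factorizations of a nonidentity \<open>f \<in> I(\<gamma>,\<beta>)\<close> through nonidentity inverse maps has the terminal object
  \<open>(f, 1\<^sub>\<beta>)\<close>, and an identity has no such factorization. Thus the matching object is the product of copies
  of \<open>\<real>\<close> over the nonidentity elements of \<open>I(\<gamma>,\<beta>)\<close>, the matching map is a projection with fibre \<open>\<real>\<close> or a
  point, and \<open>X\<close> is fibrant (\<open>fibrant_inverse_power_diagram\<close>).

  For \<open>G\<^sup>*X\<close> at \<open>\<alpha>\<close>, a point of the matching object assigns a number to each factorization
  \<open>(\<nu>, \<mu>)\<close> of each map \<open>G\<alpha> \<rightarrow> \<beta>\<close>, constant on connected components; the matching map gives all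
  factorizations of one map the same number. Over \<open>\<sigma>\<close> this is a diagonal in a product of at least two
  copies of \<open>\<real>\<close>, and the path leaving it by raising the number of a single component from 0 to 1 has no
  lift (\<open>pullback_not_fibrant\<close>).
\<close>

section \<open>Inverse maps in a Reedy category\<close>

context category
begin

lemmas cat_simps =
  Dom_in_Obj Cod_in_Obj Id_in_Arr Dom_Id Cod_Id Comp_in_Arr Dom_Comp Cod_Comp
  Comp_Id_right Comp_Id_left

end

context reedy_category
begin

lemma Direct_Arr: "f \<in> Direct C \<Longrightarrow> f \<in> Arr C"
  and Id_Direct: "x \<in> Obj C \<Longrightarrow> Id C x \<in> Direct C"
  and Comp_Direct:
    "\<lbrakk>f \<in> Direct C; g \<in> Direct C; Cod C f = Dom C g\<rbrakk> \<Longrightarrow> Comp C g f \<in> Direct C"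
  using Direct_subcategory by (auto simp: wide_subcategory_def)

lemma Inverse_Arr: "f \<in> Inverse C \<Longrightarrow> f \<in> Arr C"
  and Id_Inverse: "x \<in> Obj C \<Longrightarrow> Id C x \<in> Inverse C"
  and Comp_Inverse:
    "\<lbrakk>f \<in> Inverse C; g \<in> Inverse C; Cod C f = Dom C g\<rbrakk> \<Longrightarrow> Comp C g f \<in> Inverse C"
  using Inverse_subcategory by (auto simp: wide_subcategory_def)

lemma factorization_unique:
  assumes "d \<in> Direct C" "i \<in> Inverse C" "Cod C i = Dom C d"
    and "d' \<in> Direct C" "i' \<in> Inverse C" "Cod C i' = Dom C d'"
    and "Comp C d i = Comp C d' i'"
  shows "d = d'"
proof -
  have "Comp C d i \<in> Arr C"
    using assms by (simp add: Comp_in_Arr Direct_Arr Inverse_Arr)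
  from unique_factorization[OF this] obtain p where
    p: "\<And>q. (case q of (e, j) \<Rightarrow> e \<in> Direct C \<and> j \<in> Inverse C \<and> Cod C j = Dom C e \<and>
      Comp C d i = Comp C e j) \<Longrightarrow> q = p"
    by (elim ex1E) blast
  have "(d, i) = p" "(d', i') = p"
    using assms by (auto intro!: p)
  then show ?thesis by auto
qed

text \<open>
  Write \<open>k = d i\<close> and refactor \<open>i g = d' i'\<close>. Then \<open>k g = (d d') i'\<close> is the factorization of an inverse
  map, so \<open>d d'\<close> is an identity. Direct maps do not lower the degree, which forces \<open>d\<close> to be an identity.
\<close>

lemma Inverse_left_factor:
  assumes k: "k \<in> Arr C" and g: "g \<in> Arr C" and c: "Cod C g = Dom C k"
    and kg: "Comp C k g \<in> Inverse C"
  shows "k \<in> Inverse C"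
proof -
  obtain deg :: "_ \<Rightarrow> nat"
    where up: "\<And>f. f \<in> Direct C \<Longrightarrow> nonidentity C f \<Longrightarrow> deg (Dom C f) < deg (Cod C f)"
    using degree_exists by blast
  obtain d i where d: "d \<in> Direct C" and i: "i \<in> Inverse C" and di: "Cod C i = Dom C d"
    and kdi: "k = Comp C d i"
    using unique_factorization[OF k, THEN ex1_implies_ex] by auto
  note A = Direct_Arr[OF d] Inverse_Arr[OF i]
  have gi: "Cod C g = Dom C i" and ck: "Cod C k = Cod C d"
    using c A di by (simp_all add: kdi cat_simps)
  have ig: "Comp C i g \<in> Arr C"
    using A g gi by (simp add: Comp_in_Arr)
  obtain d' i' where d': "d' \<in> Direct C" and i': "i' \<in> Inverse C" and di': "Cod C i' = Dom C d'"
    and igdi: "Comp C i g = Comp C d' i'"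
    using unique_factorization[OF ig, THEN ex1_implies_ex] by auto
  note A' = Direct_Arr[OF d'] Inverse_Arr[OF i']
  have cd': "Cod C d' = Dom C d"
    using arg_cong[OF igdi, of "Cod C"] A A' g gi di di' by (simp add: cat_simps)
  have "Comp C k g = Comp C (Comp C d d') i'"
    using A A' g gi di di' cd' by (simp add: kdi Comp_assoc[symmetric] igdi)
  moreover have "Comp C (Id C (Cod C k)) (Comp C k g) = Comp C k g"
    using Comp_Id_left[OF Inverse_Arr[OF kg]] k g c by (simp add: Cod_Comp)
  ultimately have eq: "Comp C (Comp C d d') i' = Comp C (Id C (Cod C k)) (Comp C k g)"
    by simp
  have "Comp C d d' \<in> Direct C" "Cod C i' = Dom C (Comp C d d')"
    using d d' cd' di' A A' by (simp_all add: Comp_Direct Dom_Comp)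
  moreover have "Id C (Cod C k) \<in> Direct C" "Cod C (Comp C k g) = Dom C (Id C (Cod C k))"
    using k g c by (simp_all add: Id_Direct cat_simps)
  ultimately have dd': "Comp C d d' = Id C (Cod C k)"
    using eq i' kg by (blast intro: factorization_unique)
  have "Dom C d' = Dom C (Comp C d d')"
    using A A' cd' by (simp add: Dom_Comp)
  also have "\<dots> = Cod C d"
    unfolding dd' using A ck by (simp add: cat_simps)
  finally have "Dom C d' = Cod C d" .
  moreover have "deg (Dom C d') \<le> deg (Cod C d')"
    using up[OF d'] A' by (cases "nonidentity C d'") (simp, metis nonidentity_def Cod_Id Dom_in_Obj order_refl)
  ultimately have "\<not> nonidentity C d"
    using up[OF d] cd' by auto
  then have "k = i"
    using A di unfolding kdi nonidentity_def by (metis Comp_Id_left)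
  with i show ?thesis by simp
qed

lemma Inverse_Comp_nonidentity:
  assumes f: "f \<in> Inverse C" "f \<noteq> Id C (Dom C f)" and g: "g \<in> Inverse C"
    and c: "Cod C f = Dom C g"
  shows "Comp C g f \<noteq> Id C (Dom C f)"
proof
  assume eq: "Comp C g f = Id C (Dom C f)"
  obtain deg :: "_ \<Rightarrow> nat"
    where down: "\<And>f. f \<in> Inverse C \<Longrightarrow> nonidentity C f \<Longrightarrow> deg (Cod C f) < deg (Dom C f)"
    using degree_exists by blast
  note A = f(1)[THEN Inverse_Arr] g[THEN Inverse_Arr]
  have "deg (Cod C f) < deg (Dom C f)"
    using f down by (simp add: nonidentity_def)
  moreover have "deg (Cod C g) \<le> deg (Dom C g)"
    using down[OF g] A by (cases "nonidentity C g") (simp, metis nonidentity_def Cod_Id Dom_in_Obj order_refl)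
  moreover have "Cod C g = Dom C f"
    using arg_cong[OF eq, of "Cod C"] A c by (simp add: cat_simps)
  ultimately show False
    using c by simp
qed

end


section \<open>Disconnected nerves\<close>

definition vertex_simplex ::
  "('o, 'a, 'm) precat_scheme \<Rightarrow> 'o \<Rightarrow> (nat, nat \<times> nat, 'o, 'a) fmap" where
  "vertex_simplex J a =
     \<lparr>OMap = (\<lambda>i\<in>Obj (ordinal_cat 0). a), AMap = (\<lambda>f\<in>Arr (ordinal_cat 0). Id J a)\<rparr>"

definition edge_simplex ::
  "('o, 'a, 'm) precat_scheme \<Rightarrow> 'a \<Rightarrow> (nat, nat \<times> nat, 'o, 'a) fmap" where
  "edge_simplex J f =
     (let v = (\<lambda>i::nat. if i = 0 then Dom J f else Cod J f)
      in \<lparr>OMap = (\<lambda>i\<in>Obj (ordinal_cat 1). v i),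
          AMap = (\<lambda>(i, j)\<in>Arr (ordinal_cat 1). if i = j then Id J (v i) else f)\<rparr>)"

lemma category_ordinal_cat: "category (ordinal_cat n)"
  by unfold_locales (auto simp: ordinal_cat_def)

context category
begin

lemma edge_simplex_in_nerve:
  assumes "f \<in> Arr C"
  shows "edge_simplex C f \<in> Simp (nerve C) 1"
proof -
  interpret O: category "ordinal_cat 1" by (rule category_ordinal_cat)
  have "cat_functor (ordinal_cat 1) C (edge_simplex C f)"
  proof (unfold_locales, goal_cases)
    case (6 e g)
    then show ?case
      using assms
      by (cases e; cases g) (auto simp: edge_simplex_def ordinal_cat_def cat_simps
          split: if_splits; (metis cat_simps | linarith))
  qed (use assms in \<open>auto simp: edge_simplex_def ordinal_cat_def cat_simps le_Suc_eq\<close>)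
  then show ?thesis
    by (auto simp: nerve_def edge_simplex_def Let_def)
qed

lemma vertex_simplices_edge_rel:
  assumes "f \<in> Arr C"
  shows "(vertex_simplex C (Dom C f), vertex_simplex C (Cod C f)) \<in> edge_rel (nerve C)"
proof -
  let ?e = "edge_simplex C f"
  have "Act (nerve C) 0 (\<lambda>_. 0) ?e = vertex_simplex C (Dom C f)"
    "Act (nerve C) 0 (\<lambda>_. 1) ?e = vertex_simplex C (Cod C f)"
    by (auto simp: vertex_simplex_def nerve_def edge_simplex_def ordinal_cat_def restrict_def
        fun_eq_iff)
  then show ?thesis
    using edge_simplex_in_nerve[OF assms] unfolding edge_rel_def by force
qed

lemma vertex_of_nerve:
  assumes "F \<in> Simp (nerve C) n"
  shows "OMap F 0 \<in> Obj C"
proof -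
  interpret F: cat_functor "ordinal_cat n" C F
    using assms by (simp add: nerve_def)
  show ?thesis
    using F.OMap_in_Obj[of 0] by (simp add: ordinal_cat_def)
qed

lemma nerve_0_vertex_simplex:
  assumes "F \<in> Simp (nerve C) 0"
  shows "F = vertex_simplex C (OMap F 0)"
proof -
  interpret F: cat_functor "ordinal_cat 0" C F
    using assms by (simp add: nerve_def)
  have "OMap F \<in> extensional {0}" "AMap F \<in> extensional {(0, 0)}"
    using assms by (auto simp: nerve_def ordinal_cat_def extensional_def)
  moreover have "AMap F (0, 0) = Id C (OMap F 0)"
    using F.AMap_Id[of 0] by (simp add: ordinal_cat_def)
  ultimately have "OMap F = OMap (vertex_simplex C (OMap F 0))"
      "AMap F = AMap (vertex_simplex C (OMap F 0))"
    by (auto simp: vertex_simplex_def ordinal_cat_def extensional_def restrict_def fun_eq_iff)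
  then show ?thesis by (cases F) (simp add: vertex_simplex_def)
qed

lemma vertex_simplex_in_nerve:
  assumes "a \<in> Obj C"
  shows "vertex_simplex C a \<in> Simp (nerve C) 0"
proof -
  interpret O: category "ordinal_cat 0" by (rule category_ordinal_cat)
  have "cat_functor (ordinal_cat 0) C (vertex_simplex C a)"
    by unfold_locales
      (use assms in \<open>auto simp: vertex_simplex_def ordinal_cat_def cat_simps,
        metis Comp_Id_left Cod_Id Id_in_Arr\<close>)
  then show ?thesis
    by (auto simp: nerve_def vertex_simplex_def)
qed

text \<open>
  The set of objects whose vertices lie in one component of the nerve is a union of components of the
  category, so it separates the objects without a zigzag of arrows between them.
\<close>

lemma disconnected_nerve_separation:
  assumes "\<not> sset_empty (nerve C)" "\<not> sset_connected (nerve C)"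
  obtains S a b where "a \<in> Obj C" "a \<in> S" "b \<in> Obj C" "b \<notin> S"
    and "\<And>f. f \<in> Arr C \<Longrightarrow> Dom C f \<in> S \<longleftrightarrow> Cod C f \<in> S"
proof -
  let ?N = "nerve C" and ?v = "vertex_simplex C"
  define R where "R = (edge_rel ?N \<union> (edge_rel ?N)\<inverse>)\<^sup>*"
  have eqR: "equiv UNIV R"
    unfolding R_def by (intro equivI refl_rtrancl sym_rtrancl trans_rtrancl sym_Un_converse) simp
  obtain a where a: "a \<in> Obj C"
    using assms(1) vertex_of_nerve unfolding sset_empty_def by fast
  have "Simp ?N 0 // R \<noteq> {R `` {?v a}}"
    using assms(2) by (auto simp: sset_connected_def sset_components_def R_def is_singleton_def)
  moreover have "R `` {?v a} \<in> Simp ?N 0 // R"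
    using vertex_simplex_in_nerve[OF a] by (rule quotientI)
  ultimately obtain y where y: "y \<in> Simp ?N 0" "R `` {y} \<noteq> R `` {?v a}"
    by (auto simp: quotient_def)
  define S where "S = {c. (?v a, ?v c) \<in> R}"
  show thesis
  proof
    show "a \<in> Obj C" "OMap y 0 \<in> Obj C"
      using a vertex_of_nerve[OF y(1)] by auto
    show "a \<in> S"
      by (simp add: S_def R_def)
    show "OMap y 0 \<notin> S"
      using y(2) nerve_0_vertex_simplex[OF y(1)] equiv_class_eq[OF eqR] by (auto simp: S_def)
    fix f assume "f \<in> Arr C"
    from vertex_simplices_edge_rel[OF this]
    have "(?v (Dom C f), ?v (Cod C f)) \<in> R" "(?v (Cod C f), ?v (Dom C f)) \<in> R"
      by (auto simp: R_def)
    then show "Dom C f \<in> S \<longleftrightarrow> Cod C f \<in> S"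
      unfolding S_def R_def by (blast intro: rtrancl_trans)
  qed
qed

end


section \<open>The diagram of functions on inverse maps into a fixed object\<close>

definition inverse_hom :: "('o, 'a, 'm) reedy_scheme \<Rightarrow> 'o \<Rightarrow> 'o \<Rightarrow> 'a set" where
  "inverse_hom C \<gamma> \<beta> = {f \<in> Inverse C. Dom C f = \<gamma> \<and> Cod C f = \<beta>}"

definition inverse_power ::
  "('o, 'a, 'm) reedy_scheme \<Rightarrow> 'o \<Rightarrow> 'o \<Rightarrow> ('a \<Rightarrow> real) topology" where
  "inverse_power C \<beta> \<gamma> = product_topology (\<lambda>_. euclideanreal) (inverse_hom C \<gamma> \<beta>)"

definition precompose_or_zero ::
  "('o, 'a, 'm) reedy_scheme \<Rightarrow> 'o \<Rightarrow> 'a \<Rightarrow> ('a \<Rightarrow> real) \<Rightarrow> 'a \<Rightarrow> real" where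
  "precompose_or_zero C \<beta> g p =
     (\<lambda>f\<in>inverse_hom C (Cod C g) \<beta>. if Comp C f g \<in> Inverse C then p (Comp C f g) else 0)"

text \<open>
  Arrows of the category of spaces carry functions that are \<open>undefined\<close> off the source, hence the
  restriction.
\<close>

definition inverse_power_diagram ::
  "('o, 'a, 'm) reedy_scheme \<Rightarrow> 'o \<Rightarrow> ('o, 'a, 'a \<Rightarrow> real) diagram" where
  "inverse_power_diagram C \<beta> =
     \<lparr>OMap = inverse_power C \<beta>,
      AMap = (\<lambda>g. (inverse_power C \<beta> (Dom C g),
                   restrict (precompose_or_zero C \<beta> g) (topspace (inverse_power C \<beta> (Dom C g))),
                   inverse_power C \<beta> (Cod C g)))\<rparr>"

lemma topspace_inverse_power:
  "topspace (inverse_power C \<beta> \<gamma>) = extensional (inverse_hom C \<gamma> \<beta>)"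
  by (simp add: inverse_power_def PiE_UNIV_domain PiE_def)

lemma OMap_inverse_power_diagram [simp]:
  "OMap (inverse_power_diagram C \<beta>) = inverse_power C \<beta>"
  by (simp add: inverse_power_diagram_def)

lemma umap_inverse_power_diagram:
  "p \<in> topspace (inverse_power C \<beta> (Dom C g)) \<Longrightarrow>
   umap (inverse_power_diagram C \<beta>) g p = precompose_or_zero C \<beta> g p"
  by (simp add: inverse_power_diagram_def umap_def)

lemma continuous_map_inverse_power:
  "continuous_map S (inverse_power C \<beta> \<gamma>) h \<longleftrightarrow>
     h ` topspace S \<subseteq> extensional (inverse_hom C \<gamma> \<beta>) \<and>
     (\<forall>f\<in>inverse_hom C \<gamma> \<beta>. continuous_map S euclideanreal (\<lambda>s. h s f))"
  by (simp add: inverse_power_def continuous_map_componentwise)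

lemma continuous_map_inverse_power_eval:
  "f \<in> inverse_hom C \<gamma> \<beta> \<Longrightarrow> continuous_map (inverse_power C \<beta> \<gamma>) euclideanreal (\<lambda>p. p f)"
  unfolding inverse_power_def by (rule continuous_map_product_projection)

context reedy_category
begin

lemma continuous_map_precompose_or_zero:
  assumes "g \<in> Arr C"
  shows "continuous_map (inverse_power C \<beta> (Dom C g)) (inverse_power C \<beta> (Cod C g))
           (precompose_or_zero C \<beta> g)"
  unfolding continuous_map_inverse_power
proof (intro conjI ballI)
  fix f assume f: "f \<in> inverse_hom C (Cod C g) \<beta>"
  show "continuous_map (inverse_power C \<beta> (Dom C g)) euclideanreal (\<lambda>s. precompose_or_zero C \<beta> g s f)"
  proof (cases "Comp C f g \<in> Inverse C")
    case True
    then have "Comp C f g \<in> inverse_hom C (Dom C g) \<beta>"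
      using f assms by (auto simp: inverse_hom_def cat_simps Inverse_Arr)
    then show ?thesis
      using f True by (simp add: precompose_or_zero_def continuous_map_inverse_power_eval)
  qed (use f in \<open>simp add: precompose_or_zero_def\<close>)
qed (auto simp: precompose_or_zero_def)

lemma precompose_or_zero_Id:
  assumes "\<gamma> \<in> Obj C" "p \<in> topspace (inverse_power C \<beta> \<gamma>)"
  shows "precompose_or_zero C \<beta> (Id C \<gamma>) p = p"
proof
  fix f
  show "precompose_or_zero C \<beta> (Id C \<gamma>) p f = p f"
    using assms Comp_Id_right[of f]
    by (auto simp: precompose_or_zero_def topspace_inverse_power cat_simps restrict_def
        inverse_hom_def Inverse_Arr extensional_def)
qed

text \<open>
  If \<open>f h g\<close> is inverse, then so is its left factor \<open>f h\<close>. Hence applying \<open>g\<close> and \<open>h\<close> one after the other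
  introduces no zero that \<open>h g\<close> would not introduce.
\<close>

lemma precompose_or_zero_Comp:
  assumes g: "g \<in> Arr C" and h: "h \<in> Arr C" and c: "Cod C g = Dom C h"
  shows "precompose_or_zero C \<beta> (Comp C h g) p = precompose_or_zero C \<beta> h (precompose_or_zero C \<beta> g p)"
proof
  fix f
  show "precompose_or_zero C \<beta> (Comp C h g) p f = precompose_or_zero C \<beta> h (precompose_or_zero C \<beta> g p) f"
  proof (cases "f \<in> inverse_hom C (Cod C h) \<beta>")
    case True
    then have f: "f \<in> Arr C" "Dom C f = Cod C h" "Cod C f = \<beta>"
      by (auto simp: inverse_hom_def Inverse_Arr)
    have as: "Comp C f (Comp C h g) = Comp C (Comp C f h) g"
      using f g h c by (simp add: Comp_assoc)
    have "Comp C f h \<in> Inverse C" if "Comp C (Comp C f h) g \<in> Inverse C"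
      using f g h c by (intro Inverse_left_factor[OF _ g _ that]) (auto simp: cat_simps)
    moreover have "Comp C f h \<in> inverse_hom C (Cod C g) \<beta>" if "Comp C f h \<in> Inverse C"
      using that f h c by (simp add: inverse_hom_def cat_simps)
    ultimately show ?thesis
      using True g h c by (auto simp: precompose_or_zero_def as Cod_Comp)
  qed (use g h c in \<open>simp add: precompose_or_zero_def Cod_Comp\<close>)
qed

lemma diagram_inverse_power_diagram: "diagram C (inverse_power_diagram C \<beta>)"
proof -
  interpret T: category TOP by (rule category_TOP)
  show ?thesis
  proof (unfold_locales, goal_cases)
    case (2 f)
    then show ?case
      by (auto simp: inverse_power_diagram_def TOP_def
          intro: continuous_map_eq[OF continuous_map_precompose_or_zero])
  next
    case (5 x)
    then show ?case
      by (auto simp: inverse_power_diagram_def TOP_def cat_simps precompose_or_zero_Id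
          intro!: restrict_ext)
  next
    case (6 f g)
    have "precompose_or_zero C \<beta> f p \<in> topspace (inverse_power C \<beta> (Dom C g))"
      if "p \<in> topspace (inverse_power C \<beta> (Dom C f))" for p
      using continuous_map_precompose_or_zero[OF 6(1), of \<beta>] that 6(3)
      by (auto simp: continuous_map_def)
    with 6 show ?case
      by (auto simp: inverse_power_diagram_def TOP_def cat_simps precompose_or_zero_Comp compose_def
          intro!: restrict_ext)
  qed (auto simp: inverse_power_diagram_def TOP_def)
qed

end


section \<open>Matching maps\<close>

lemma umap_continuous:
  assumes "diagram C X" "f \<in> Arr C"
  shows "continuous_map (OMap X (Dom C f)) (OMap X (Cod C f)) (umap X f)"
proof -
  interpret X: cat_functor C TOP X by fact
  show ?thesis
    using X.AMap_in_Arr[of f] X.Dom_AMap[of f] X.Cod_AMap[of f] assms(2)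
    by (auto simp: TOP_def umap_def)
qed

lemma umap_Comp:
  assumes "diagram C X" "f \<in> Arr C" "g \<in> Arr C" "Cod C f = Dom C g"
    and "x \<in> topspace (OMap X (Dom C f))"
  shows "umap X (Comp C g f) x = umap X g (umap X f x)"
proof -
  interpret X: cat_functor C TOP X by fact
  show ?thesis
    using X.AMap_Comp[of f g] X.Dom_AMap[of f] assms
    by (auto simp: TOP_def umap_def compose_def split_beta)
qed

lemma Obj_matching_cat:
  "Obj (matching_cat C \<alpha>) = {\<nu> \<in> Inverse C. Dom C \<nu> = \<alpha> \<and> \<nu> \<noteq> Id C \<alpha>}"
  by (simp add: matching_cat_def)

lemma Arr_matching_cat:
  "Arr (matching_cat C \<alpha>) =
     {(\<nu>, \<tau>, \<nu>'). \<nu> \<in> Obj (matching_cat C \<alpha>) \<and> \<nu>' \<in> Obj (matching_cat C \<alpha>) \<and> \<tau> \<in> Inverse C \<and>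
        Dom C \<tau> = Cod C \<nu> \<and> Cod C \<tau> = Cod C \<nu>' \<and> Comp C \<tau> \<nu> = \<nu>'}"
  by (simp add: matching_cat_def)

lemma continuous_map_matching_object:
  "continuous_map S (matching_object C X \<alpha>) h \<longleftrightarrow>
     h ` topspace S \<subseteq> extensional (Obj (matching_cat C \<alpha>)) \<and>
     (\<forall>\<nu>\<in>Obj (matching_cat C \<alpha>). continuous_map S (OMap X (Cod C \<nu>)) (\<lambda>s. h s \<nu>)) \<and>
     (\<forall>(\<nu>, \<tau>, \<nu>')\<in>Arr (matching_cat C \<alpha>). \<forall>s\<in>topspace S. umap X \<tau> (h s \<nu>) = h s \<nu>')"
proof -
  have "umap (fmap_comp X (matching_forget C)) (\<nu>, \<tau>, \<nu>') = umap X \<tau>" for \<nu> \<tau> \<nu>'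
    by (simp add: umap_def fmap_comp_def matching_forget_def)
  then show ?thesis
    unfolding matching_object_def continuous_map_diagram_limit
    by (auto simp: fmap_comp_def matching_forget_def matching_cat_def)
qed

lemma matching_object_point:
  assumes "m \<in> topspace (matching_object C X \<alpha>)"
  shows "m \<in> extensional (Obj (matching_cat C \<alpha>))"
    and "\<nu> \<in> Obj (matching_cat C \<alpha>) \<Longrightarrow> m \<nu> \<in> topspace (OMap X (Cod C \<nu>))"
    and "(\<nu>, \<tau>, \<nu>') \<in> Arr (matching_cat C \<alpha>) \<Longrightarrow> umap X \<tau> (m \<nu>) = m \<nu>'"
  using assms continuous_map_id[of "matching_object C X \<alpha>"]
  unfolding continuous_map_matching_object by (auto simp: continuous_map_def)

lemma continuous_map_matching_map:
  assumes "reedy_category C" "diagram C X"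
  shows "continuous_map (OMap X \<alpha>) (matching_object C X \<alpha>) (matching_map C X \<alpha>)"
proof -
  interpret reedy_category C by fact
  show ?thesis
    unfolding continuous_map_matching_object
    using umap_continuous[OF assms(2)] umap_Comp[OF assms(2)]
    by (auto simp: matching_map_def Arr_matching_cat Obj_matching_cat Inverse_Arr)
qed

context reedy_category
begin

text \<open>
  A point \<open>m\<close> of the matching object at \<open>\<gamma>\<close> is determined by the numbers \<open>m f 1\<^sub>\<beta>\<close> for nonidentity inverse
  \<open>f: \<gamma> \<rightarrow> \<beta>\<close>, because the map \<open>\<mu>\<close> of the matching category from \<open>\<nu>\<close> to \<open>\<mu> \<nu>\<close> forces
  \<open>m \<nu> \<mu> = m (\<mu> \<nu>) 1\<^sub>\<beta>\<close>. A homotopy in the matching object therefore prescribes every coordinate of its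
  lift except that of \<open>1\<^sub>\<gamma>\<close>, which exists only for \<open>\<gamma> = \<beta>\<close> and can be kept constant.
\<close>

lemma fibrant_inverse_power_diagram:
  assumes \<beta>: "\<beta> \<in> Obj C"
  shows "reedy_fibrant C (inverse_power_diagram C \<beta>)"
  unfolding reedy_fibrant_iff serre_fibration_def
proof (intro ballI conjI allI impI)
  let ?X = "inverse_power_diagram C \<beta>"
  fix \<gamma> assume \<gamma>: "\<gamma> \<in> Obj C"
  let ?M = "matching_object C ?X \<gamma>" and ?J = "Obj (matching_cat C \<gamma>)"
  let ?L = "inverse_hom C \<gamma> \<beta>"
  show "continuous_map (OMap ?X \<gamma>) ?M (matching_map C ?X \<gamma>)"
    using reedy_category_axioms diagram_inverse_power_diagram by (rule continuous_map_matching_map)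
  have id\<beta>: "Id C \<beta> \<in> inverse_hom C \<beta> \<beta>"
    using \<beta> by (simp add: inverse_hom_def Id_Inverse cat_simps)
  have obj: "f \<in> ?J \<and> Cod C f = \<beta>" if "f \<in> ?L" "f \<noteq> Id C \<gamma>" for f
    using that by (simp add: inverse_hom_def Obj_matching_cat)

  have determined: "m \<nu> \<mu> = m (Comp C \<mu> \<nu>) (Id C \<beta>)" and composite: "Comp C \<mu> \<nu> \<in> ?L" "Comp C \<mu> \<nu> \<noteq> Id C \<gamma>"
    if m: "m \<in> topspace ?M" and \<nu>: "\<nu> \<in> ?J" and \<mu>: "\<mu> \<in> inverse_hom C (Cod C \<nu>) \<beta>" for m \<nu> \<mu>
  proof -
    have i: "\<nu> \<in> Inverse C" "Dom C \<nu> = \<gamma>" "\<nu> \<noteq> Id C \<gamma>"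
      "\<mu> \<in> Inverse C" "Dom C \<mu> = Cod C \<nu>" "Cod C \<mu> = \<beta>"
      using \<nu> \<mu> by (auto simp: Obj_matching_cat inverse_hom_def)
    show c: "Comp C \<mu> \<nu> \<in> ?L" "Comp C \<mu> \<nu> \<noteq> Id C \<gamma>"
      using i Inverse_Comp_nonidentity[of \<nu> \<mu>]
      by (auto simp: inverse_hom_def Comp_Inverse Inverse_Arr cat_simps)
    have "(\<nu>, \<mu>, Comp C \<mu> \<nu>) \<in> Arr (matching_cat C \<gamma>)"
      using \<nu> i c by (auto simp: Arr_matching_cat Obj_matching_cat inverse_hom_def)
    from matching_object_point(3)[OF m this] matching_object_point(2)[OF m \<nu>]
    have "m (Comp C \<mu> \<nu>) = precompose_or_zero C \<beta> \<mu> (m \<nu>)"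
      using i by (simp add: umap_inverse_power_diagram)
    then show "m \<nu> \<mu> = m (Comp C \<mu> \<nu>) (Id C \<beta>)"
      using i id\<beta> Comp_Id_left[of \<mu>] by (simp add: precompose_or_zero_def Inverse_Arr)
  qed

  fix n h H
  let ?D = "disk n" and ?DI = "prod_topology (disk n) (top_of_set {0..1::real})"
  assume "continuous_map ?D (OMap ?X \<gamma>) h \<and> continuous_map ?DI ?M H \<and>
    (\<forall>x\<in>topspace ?D. H (x, 0) = matching_map C ?X \<gamma> (h x))"
  then have h: "continuous_map ?D (inverse_power C \<beta> \<gamma>) h" and H: "continuous_map ?DI ?M H"
    and H0: "\<And>x. x \<in> topspace ?D \<Longrightarrow> H (x, 0) = matching_map C ?X \<gamma> (h x)"
    by auto
  have h_ext: "h x \<in> extensional ?L" if "x \<in> topspace ?D" for x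
    using h that by (auto simp: continuous_map_inverse_power)
  have matching: "matching_map C ?X \<gamma> p \<nu> \<mu> = p (Comp C \<mu> \<nu>)"
    if "p \<in> extensional ?L" "\<nu> \<in> ?J" "\<mu> \<in> inverse_hom C (Cod C \<nu>) \<beta>" for p \<nu> \<mu>
    using that
    by (auto simp: matching_map_def umap_inverse_power_diagram topspace_inverse_power
        Obj_matching_cat precompose_or_zero_def inverse_hom_def Comp_Inverse)
  define K where
    "K = (\<lambda>z. \<lambda>f\<in>?L. if f = Id C \<gamma> then h (fst z) f else H z f (Id C \<beta>))"
  have "continuous_map ?DI (inverse_power C \<beta> \<gamma>) K"
    unfolding continuous_map_inverse_power
  proof (intro conjI ballI)
    fix f assume f: "f \<in> ?L"
    show "continuous_map ?DI euclideanreal (\<lambda>z. K z f)"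
    proof (cases "f = Id C \<gamma>")
      case True
      have "continuous_map ?D euclideanreal (\<lambda>x. h x f)"
        using h f by (simp add: continuous_map_inverse_power)
      from continuous_map_compose[OF continuous_map_fst this] show ?thesis
        using True f by (simp add: K_def o_def)
    next
      case False
      then have "continuous_map ?DI (inverse_power C \<beta> \<beta>) (\<lambda>z. H z f)"
        using H obj[OF f] by (auto simp: continuous_map_matching_object)
      then show ?thesis
        using False f id\<beta> by (simp add: K_def continuous_map_inverse_power)
    qed
  qed (auto simp: K_def)
  moreover have "K (x, 0) = h x" if x: "x \<in> topspace ?D" for x
  proof
    fix f
    show "K (x, 0) f = h x f"
    proof (cases "f \<in> ?L")
      case True
      have "matching_map C ?X \<gamma> (h x) f (Id C \<beta>) = h x f" if "f \<noteq> Id C \<gamma>"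
        using matching[OF h_ext[OF x], of f "Id C \<beta>"] obj[OF True that] id\<beta> True Comp_Id_left[of f]
        by (simp add: inverse_hom_def Inverse_Arr)
      then show ?thesis
        using True by (simp add: K_def H0[OF x])
    next
      case False
      then show ?thesis
        using h_ext[OF x] by (simp add: K_def extensional_def)
    qed
  qed
  moreover have "matching_map C ?X \<gamma> (K z) = H z" if z: "z \<in> topspace ?D \<times> {0..1}" for z
  proof
    fix \<nu>
    have m: "H z \<in> topspace ?M"
      using continuous_map_image_subset_topspace[OF H] z by auto
    have k: "K z \<in> extensional ?L"
      by (simp add: K_def)
    show "matching_map C ?X \<gamma> (K z) \<nu> = H z \<nu>"
    proof (cases "\<nu> \<in> ?J")
      case True
      have "continuous_map (OMap ?X \<gamma>) ?M (matching_map C ?X \<gamma>)"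
        using reedy_category_axioms diagram_inverse_power_diagram
        by (rule continuous_map_matching_map)
      then have Kz: "matching_map C ?X \<gamma> (K z) \<in> topspace ?M"
        using k by (auto simp: continuous_map_def topspace_inverse_power)
      then have ext: "matching_map C ?X \<gamma> (K z) \<nu> \<in> extensional (inverse_hom C (Cod C \<nu>) \<beta>)"
          "H z \<nu> \<in> extensional (inverse_hom C (Cod C \<nu>) \<beta>)"
        using matching_object_point(2)[OF Kz True] matching_object_point(2)[OF m True]
        by (simp_all add: topspace_inverse_power)
      show ?thesis
      proof (rule extensionalityI[OF ext])
        fix \<mu> assume \<mu>: "\<mu> \<in> inverse_hom C (Cod C \<nu>) \<beta>"
        show "matching_map C ?X \<gamma> (K z) \<nu> \<mu> = H z \<nu> \<mu>"
          unfolding matching[OF k True \<mu>]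
          using determined[OF m True \<mu>] composite[OF m True \<mu>] by (simp add: K_def)
      qed
    next
      case False
      then show ?thesis
        using matching_object_point(1)[OF m] by (simp add: matching_map_def extensional_def)
    qed
  qed
  ultimately show "\<exists>K. continuous_map ?DI (OMap ?X \<gamma>) K \<and> (\<forall>x\<in>topspace ?D. K (x, 0) = h x) \<and>
      (\<forall>z\<in>topspace ?D \<times> {0..1}. matching_map C ?X \<gamma> (K z) = H z)"
    by (intro exI[of _ K]) auto
qed

end


section \<open>Pulling back along a functor that is not fibering\<close>

text \<open>
  The set \<open>S\<close> is a union of components of the category of factorizations of \<open>\<sigma>\<close>, so the path that gives
  the factorizations in \<open>S\<close> the number \<open>t\<close> at time \<open>t\<close>, and all others the number 0, runs in the matching
  object. It starts at the image of the zero function. A lift would give every factorization of \<open>\<sigma>\<close>,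
  whether in \<open>S\<close> or not, the value of one function at \<open>\<sigma>\<close>.
\<close>

lemma pullback_not_fibrant:
  assumes G: "reedy_functor C D G"
    and \<alpha>: "\<alpha> \<in> Obj C" and \<sigma>: "\<sigma> \<in> inverse_hom D (OMap G \<alpha>) \<beta>"
    and a: "a \<in> Obj (inverse_fact_cat C D G \<alpha> \<sigma>)" "a \<in> S"
    and b: "b \<in> Obj (inverse_fact_cat C D G \<alpha> \<sigma>)" "b \<notin> S"
    and closed: "\<And>f. f \<in> Arr (inverse_fact_cat C D G \<alpha> \<sigma>) \<Longrightarrow>
      Dom (inverse_fact_cat C D G \<alpha> \<sigma>) f \<in> S \<longleftrightarrow> Cod (inverse_fact_cat C D G \<alpha> \<sigma>) f \<in> S"
  shows "\<not> reedy_fibrant C (fmap_comp (inverse_power_diagram D \<beta>) G)"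
proof
  interpret reedy_functor C D G by fact
  let ?F = "inverse_fact_cat C D G \<alpha> \<sigma>"
  let ?X = "inverse_power_diagram D \<beta>" and ?Y = "fmap_comp (inverse_power_diagram D \<beta>) G"
  let ?M = "matching_object C ?Y \<alpha>" and ?J = "Obj (matching_cat C \<alpha>)"
  let ?L = "\<lambda>\<nu>. inverse_hom D (OMap G (Cod C \<nu>)) \<beta>"
  let ?I = "prod_topology (disk 0) (top_of_set {0..1::real})"
  have OY: "OMap ?Y \<gamma> = inverse_power D \<beta> (OMap G \<gamma>)" for \<gamma>
    by (simp add: fmap_comp_def)
  have UY: "umap ?Y \<nu> p = precompose_or_zero D \<beta> (AMap G \<nu>) p"
    if "\<nu> \<in> Arr C" "p \<in> topspace (inverse_power D \<beta> (OMap G (Dom C \<nu>)))" for \<nu> p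
    using that umap_inverse_power_diagram[of p D \<beta> "AMap G \<nu>"]
    by (simp add: umap_def fmap_comp_def Dom_AMap)
  have GI: "AMap G \<nu> \<in> Inverse D" if "\<nu> \<in> Inverse C" for \<nu>
    using that AMap_Inverse by auto
  have Obj_F: "(\<nu>, \<mu>) \<in> Obj ?F \<longleftrightarrow> \<nu> \<in> ?J \<and> \<mu> \<in> ?L \<nu> \<and> Comp D \<mu> (AMap G \<nu>) = \<sigma>" for \<nu> \<mu>
    using \<sigma> by (auto simp: inverse_fact_cat_def Let_def Obj_matching_cat nonidentity_def
        inverse_hom_def)
  have closed': "(\<nu>, \<mu>) \<in> S \<longleftrightarrow> (\<nu>', \<mu>') \<in> S"
    if "(\<nu>, \<mu>) \<in> Obj ?F" "(\<nu>', \<mu>') \<in> Obj ?F" "(\<nu>, \<tau>, \<nu>') \<in> Arr (matching_cat C \<alpha>)"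
      "Comp D \<mu>' (AMap G \<tau>) = \<mu>" for \<nu> \<mu> \<tau> \<nu>' \<mu>'
    using closed[of "((\<nu>, \<mu>), \<tau>, (\<nu>', \<mu>'))"] that
    by (auto simp: inverse_fact_cat_def Let_def Arr_matching_cat)

  \<comment> \<open>The disk of dimension 0 is a point, so a homotopy on it is a path; the time is \<open>snd z\<close>.\<close>
  define H where "H = (\<lambda>z::(nat \<Rightarrow> real) \<times> real. \<lambda>\<nu>\<in>?J. \<lambda>\<mu>\<in>?L \<nu>.
    if (\<nu>, \<mu>) \<in> Obj ?F \<inter> S then snd z else 0)"
  have Hcont: "continuous_map ?I ?M H"
    unfolding continuous_map_matching_object
  proof (intro conjI ballI)
    show "H ` topspace ?I \<subseteq> extensional ?J"
      by (auto simp: H_def)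
  next
    fix \<nu> assume \<nu>: "\<nu> \<in> ?J"
    have "continuous_map ?I euclideanreal snd"
      using continuous_map_into_fulltopology[OF continuous_map_snd] .
    then show "continuous_map ?I (OMap ?Y (Cod C \<nu>)) (\<lambda>z. H z \<nu>)"
      using \<nu> by (auto simp: OY continuous_map_inverse_power H_def)
  next
    fix f assume f: "f \<in> Arr (matching_cat C \<alpha>)"
    obtain \<nu> \<tau> \<nu>' where f_def: "f = (\<nu>, \<tau>, \<nu>')"
      by (cases f)
    have i: "\<nu> \<in> ?J" "\<nu>' \<in> ?J" "\<nu> \<in> Inverse C" "\<tau> \<in> Inverse C" "Dom C \<tau> = Cod C \<nu>"
        "Cod C \<tau> = Cod C \<nu>'" "Comp C \<tau> \<nu> = \<nu>'"
      using f by (auto simp: f_def Arr_matching_cat Obj_matching_cat)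
    note A = i(3,4)[THEN src.Inverse_Arr]
    have "umap ?Y \<tau> (H s \<nu>) = H s \<nu>'" for s
    proof -
      have "H s \<nu> \<in> topspace (inverse_power D \<beta> (OMap G (Dom C \<tau>)))"
        using i by (simp add: topspace_inverse_power H_def)
      then have "umap ?Y \<tau> (H s \<nu>) = precompose_or_zero D \<beta> (AMap G \<tau>) (H s \<nu>)"
        using A by (simp add: UY)
      also have "\<dots> = H s \<nu>'"
      proof (rule extensionalityI)
        show "precompose_or_zero D \<beta> (AMap G \<tau>) (H s \<nu>) \<in> extensional (?L \<nu>')"
          using A i by (simp add: precompose_or_zero_def Cod_AMap)
        show "H s \<nu>' \<in> extensional (?L \<nu>')"
          using i by (simp add: H_def)
        fix \<mu>' assume \<mu>': "\<mu>' \<in> ?L \<nu>'"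
        let ?\<mu> = "Comp D \<mu>' (AMap G \<tau>)"
        have \<mu>: "?\<mu> \<in> ?L \<nu>"
          using \<mu>' A i GI
          by (auto simp: inverse_hom_def tgt.cat_simps tgt.Comp_Inverse tgt.Inverse_Arr
              AMap_in_Arr Dom_AMap Cod_AMap)
        have "Comp D ?\<mu> (AMap G \<nu>) = Comp D \<mu>' (Comp D (AMap G \<tau>) (AMap G \<nu>))"
          using \<mu>' A i
          by (intro tgt.Comp_assoc[symmetric])
            (auto simp: inverse_hom_def tgt.Inverse_Arr AMap_in_Arr Dom_AMap Cod_AMap)
        also have "\<dots> = Comp D \<mu>' (AMap G \<nu>')"
          using A i AMap_Comp[of \<nu> \<tau>] by simp
        \<comment> \<open>Both pairs factor the same map, and \<open>\<tau>\<close> is an arrow between them if that map is \<open>\<sigma>\<close>.\<close>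
        finally have "(\<nu>, ?\<mu>) \<in> Obj ?F \<longleftrightarrow> (\<nu>', \<mu>') \<in> Obj ?F"
          using \<mu> \<mu>' i by (simp add: Obj_F)
        then have "(\<nu>, ?\<mu>) \<in> Obj ?F \<inter> S \<longleftrightarrow> (\<nu>', \<mu>') \<in> Obj ?F \<inter> S"
          using closed' f f_def by blast
        moreover have "?\<mu> \<in> Inverse D" "\<mu>' \<in> inverse_hom D (Cod D (AMap G \<tau>)) \<beta>"
          using \<mu> \<mu>' A i by (auto simp: inverse_hom_def Cod_AMap)
        ultimately show "precompose_or_zero D \<beta> (AMap G \<tau>) (H s \<nu>) \<mu>' = H s \<nu>' \<mu>'"
          using \<mu> \<mu>' i unfolding precompose_or_zero_def H_def by simp
      qed
      finally show ?thesis .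
    qed
    then show "case f of (\<nu>, \<tau>, \<nu>') \<Rightarrow> \<forall>s\<in>topspace ?I. umap ?Y \<tau> (H s \<nu>) = H s \<nu>'"
      by (simp add: f_def)
  qed

  have matching: "matching_map C ?Y \<alpha> p \<nu> \<mu> = p \<sigma>"
    if "p \<in> topspace (inverse_power D \<beta> (OMap G \<alpha>))" "(\<nu>, \<mu>) \<in> Obj ?F" for p \<nu> \<mu>
  proof -
    have i: "\<nu> \<in> ?J" "\<nu> \<in> Inverse C" "\<nu> \<in> Arr C" "Dom C \<nu> = \<alpha>" "\<mu> \<in> ?L \<nu>"
        "Comp D \<mu> (AMap G \<nu>) = \<sigma>"
      using that(2) by (auto simp: Obj_F Obj_matching_cat src.Inverse_Arr)
    then show ?thesis
      using that(1) \<sigma> UY[of \<nu> p]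
      by (simp add: matching_map_def precompose_or_zero_def Cod_AMap inverse_hom_def)
  qed
  define h where "h = (\<lambda>x::nat \<Rightarrow> real. \<lambda>f\<in>inverse_hom D (OMap G \<alpha>) \<beta>. 0::real)"
  have h: "continuous_map (disk 0) (OMap ?Y \<alpha>) h"
    by (auto simp: OY continuous_map_inverse_power topspace_inverse_power h_def)
  have H0: "H (x, 0) = matching_map C ?Y \<alpha> (h x)" for x
  proof
    fix \<nu>
    have "h x \<in> topspace (inverse_power D \<beta> (OMap G \<alpha>))"
      by (simp add: topspace_inverse_power h_def)
    moreover have "Comp D \<mu> (AMap G \<nu>) \<in> inverse_hom D (OMap G \<alpha>) \<beta>"
      if "\<nu> \<in> ?J" "\<mu> \<in> ?L \<nu>" for \<mu>
      using that GI src.Inverse_Arr[of \<nu>]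
      by (auto simp: inverse_hom_def Obj_matching_cat tgt.cat_simps tgt.Comp_Inverse
          tgt.Inverse_Arr AMap_in_Arr Dom_AMap Cod_AMap)
    ultimately show "H (x, 0) \<nu> = matching_map C ?Y \<alpha> (h x) \<nu>"
      using UY[of \<nu> "h x"] src.Inverse_Arr[of \<nu>]
      by (auto simp: H_def matching_map_def precompose_or_zero_def Obj_matching_cat Cod_AMap h_def
          intro!: restrict_ext)
  qed
  assume "reedy_fibrant C ?Y"
  with \<alpha> have "serre_fibration (OMap ?Y \<alpha>) ?M (matching_map C ?Y \<alpha>)"
    by (simp add: reedy_fibrant_iff)
  with h Hcont H0 obtain K where K: "continuous_map ?I (OMap ?Y \<alpha>) K"
    "\<And>z. z \<in> topspace (disk 0) \<times> {0..1} \<Longrightarrow> matching_map C ?Y \<alpha> (K z) = H z"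
    unfolding serre_fibration_def by metis
  define z where "z = ((\<lambda>_. 0) :: nat \<Rightarrow> real, 1 :: real)"
  have z: "z \<in> topspace (disk 0) \<times> {0..1}"
    by (simp add: z_def disk_def topspace_Euclidean_space)
  then have Kz: "K z \<in> topspace (inverse_power D \<beta> (OMap G \<alpha>))"
    using continuous_map_image_subset_topspace[OF K(1)] by (auto simp: OY)
  obtain \<nu> \<mu> \<nu>' \<mu>' where ab: "a = (\<nu>, \<mu>)" "b = (\<nu>', \<mu>')"
    by (cases a, cases b)
  have "H z \<nu> \<mu> = K z \<sigma>" "H z \<nu>' \<mu>' = K z \<sigma>"
    using matching[OF Kz] K(2)[OF z] a(1) b(1) ab by metis+
  moreover have "H z \<nu> \<mu> = 1" "H z \<nu>' \<mu>' = 0"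
    using a b ab by (auto simp: H_def Obj_F z_def)
  ultimately show False
    by simp
qed

theorem theorem4p3:
  fixes C :: "('o, 'a) reedy"
    and D :: "('p, 'b) reedy"
    and G :: "('o, 'a, 'p, 'b) fmap"
  assumes "reedy_category C"
    and "reedy_category D"
    and "reedy_functor C D G"
    and "\<not> fibering_reedy_functor C D G"
  shows "\<exists>X :: ('p, 'b, 'b \<Rightarrow> real) diagram.
           diagram D X \<and> reedy_fibrant D X \<and> \<not> reedy_fibrant C (fmap_comp X G)"
proof -
  interpret D: reedy_category D by fact
  obtain \<alpha> \<beta> \<sigma> where *: "\<alpha> \<in> Obj C" "\<beta> \<in> Obj D" "\<sigma> \<in> Inverse D" "Dom D \<sigma> = OMap G \<alpha>" "Cod D \<sigma> = \<beta>"
    and disc: "\<not> sset_empty (nerve (inverse_fact_cat C D G \<alpha> \<sigma>))"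
      "\<not> sset_connected (nerve (inverse_fact_cat C D G \<alpha> \<sigma>))"
    using assms(3,4) unfolding fibering_reedy_functor_def by blast
  interpret F: category "inverse_fact_cat C D G \<alpha> \<sigma>"
    using category_inverse_fact_cat[OF assms(3) *(1,3)] .
  from disc obtain S a b
    where "a \<in> Obj (inverse_fact_cat C D G \<alpha> \<sigma>)" "a \<in> S"
      "b \<in> Obj (inverse_fact_cat C D G \<alpha> \<sigma>)" "b \<notin> S"
      "\<And>f. f \<in> Arr (inverse_fact_cat C D G \<alpha> \<sigma>) \<Longrightarrow>
        Dom (inverse_fact_cat C D G \<alpha> \<sigma>) f \<in> S \<longleftrightarrow> Cod (inverse_fact_cat C D G \<alpha> \<sigma>) f \<in> S"
    by (rule F.disconnected_nerve_separation) (rule that)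
  then have "\<not> reedy_fibrant C (fmap_comp (inverse_power_diagram D \<beta>) G)"
    using * by (intro pullback_not_fibrant[OF assms(3)]) (auto simp: inverse_hom_def)
  then show ?thesis
    using D.diagram_inverse_power_diagram D.fibrant_inverse_power_diagram[OF *(2)] by blast
qed

end
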